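(* Let $m,n$ be positive integers and let $\sigma:[m]\to[n]$ be a random function such that $\sigma(1),\ldots,\sigma(m)$ are independent (not necessarily identically distributed) random variables with values in $[n]$. For $j\in[n]$ let $B_j:=|\sigma^{-1}(j)|$. Let $\mu$ be the law of $(B_1,\ldots,B_n)$, a probability measure on $\mathbb{N}^n$. Then $\mu$ is conditionally negatively associated (CNA).
   Context: Notation: $\mathbb{N}=\{0,1,2,\ldots\}$, $[n]=\{1,\ldots,n\}$; $\mathbb{N}^n$ carries the coordinatewise partial order $\le$; $\mathrm{x}_j$ denotes the $j$-th coordinate of $\mathbf{x}\in\mathbb{N}^n$. An event $\mathcal{A}\subseteq\mathbb{N}^n$ is increasing if $\mathbf{x}\in\mathcal{A}$, $\mathbf{y}\in\mathbb{N}^n$ and $\mathbf{x}\le\mathbf{y}$ imply $\mathbf{y}\in\mathcal{A}$. A coordinate $j\in[n]$ affects $\mathcal{A}$ if there exist $\mathbf{x}\in\mathcal{A}$ and $\mathbf{y}\in\mathbb{N}^n\setminus\mathcal{A}$ with $\mathrm{x}_i=\mathrm{y}_i$ for all $i\in[n]\setminus\{j\}$. Write $\mathcal{A}\perp\mathcal{B}$ if no coordinate affects both $\mathcal{A}$ and $\mathcal{B}$. A probability measure $\mu$ on $\mathbb{N}^n$ is negatively associated (NA) if $\mu(\mathcal{A}\cap\mathcal{B})\le\mu(\mathcal{A})\mu(\mathcal{B})$ for all increasing events $\mathcal{A},\mathcal{B}\subseteq\mathbb{N}^n$ with $\mathcal{A}\perp\mathcal{B}$. A probability measure $\mu$ on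 $\mathbb{N}^n$ is conditionally negatively associated (CNA) if for all $a_1,\ldots,a_n\in\mathbb{N}$ and all $S\subseteq[n]$ such that the event $\{\mathrm{x}_i=a_i\text{ for all }i\in S\}$ has positive $\mu$-probability, the conditional measure $\mu(\cdot\mid \mathrm{x}_i=a_i\text{ for all }i\in S)$ is negatively associated. *)

theory Defs
  imports "HOL-Probability.Probability"
begin

(* Points of N^n are functions with domain {1..n}, in the extensional sense of FuncSet. *)
definition Nvec :: "nat \<Rightarrow> (nat \<Rightarrow> nat) set" where
  "Nvec n = {1..n} \<rightarrow>\<^sub>E UNIV"

definition increasing_event :: "nat \<Rightarrow> (nat \<Rightarrow> nat) set \<Rightarrow> bool" where
  "increasing_event n A \<longleftrightarrow> A \<subseteq> Nvec n \<and>
     (\<forall>x\<in>A. \<forall>y\<in>Nvec n. (\<forall>i\<in>{1..n}. x i \<le> y i) \<longrightarrow> y \<in> A)"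

definition affects :: "nat \<Rightarrow> nat \<Rightarrow> (nat \<Rightarrow> nat) set \<Rightarrow> bool" where
  "affects n j A \<longleftrightarrow>
     (\<exists>x\<in>A. \<exists>y\<in>Nvec n - A. \<forall>i\<in>{1..n} - {j}. x i = y i)"

definition event_perp :: "nat \<Rightarrow> (nat \<Rightarrow> nat) set \<Rightarrow> (nat \<Rightarrow> nat) set \<Rightarrow> bool" where
  "event_perp n A B \<longleftrightarrow> \<not> (\<exists>j\<in>{1..n}. affects n j A \<and> affects n j B)"

(* N^n is countable, so its probability measures are taken on the full power set. *)
definition prob_measure_on_Nvec :: "nat \<Rightarrow> (nat \<Rightarrow> nat) measure \<Rightarrow> bool" where
  "prob_measure_on_Nvec n \<mu> \<longleftrightarrow> prob_space \<mu> \<and> sets \<mu> = Pow (Nvec n)"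

definition negatively_associated :: "nat \<Rightarrow> (nat \<Rightarrow> nat) measure \<Rightarrow> bool" where
  "negatively_associated n \<mu> \<longleftrightarrow> prob_measure_on_Nvec n \<mu> \<and>
     (\<forall>A B. increasing_event n A \<longrightarrow> increasing_event n B \<longrightarrow> event_perp n A B \<longrightarrow>
        measure \<mu> (A \<inter> B) \<le> measure \<mu> A * measure \<mu> B)"

definition coord_event :: "nat \<Rightarrow> nat set \<Rightarrow> (nat \<Rightarrow> nat) \<Rightarrow> (nat \<Rightarrow> nat) set" where
  "coord_event n S a = {x \<in> Nvec n. \<forall>i\<in>S. x i = a i}"

(* uniform_measure M E is the conditional measure A |-> M (E Int A) / M E. *)
definition conditionally_negatively_associated ::
    "nat \<Rightarrow> (nat \<Rightarrow> nat) measure \<Rightarrow> bool" where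
  "conditionally_negatively_associated n \<mu> \<longleftrightarrow> prob_measure_on_Nvec n \<mu> \<and>
     (\<forall>a. \<forall>S\<subseteq>{1..n}. measure \<mu> (coord_event n S a) > 0 \<longrightarrow>
        negatively_associated n (uniform_measure \<mu> (coord_event n S a)))"

definition occupancy :: "nat \<Rightarrow> nat \<Rightarrow> (nat \<Rightarrow> nat) \<Rightarrow> nat \<Rightarrow> nat" where
  "occupancy m n f = (\<lambda>j\<in>{1..n}. card {i \<in> {1..m}. f i = j})"

end

theory Submission imports Defs begin

text \<open>
  Let \<open>C\<close> be the conditioning event, and let \<open>A\<close>, \<open>B\<close> be increasing events affected by disjoint
  sets \<open>J\<close>, \<open>K\<close> of urns. Since the urns in \<open>S\<close> have prescribed contents on \<open>C\<close>, one may take \<open>J\<close>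
  and \<open>K\<close> disjoint from \<open>S\<close>. The claim is \<open>P(A B C) P(C) \<le> P(A C) P(B C)\<close>. Both sides are sums
  over pairs \<open>(s, t)\<close> of placements of the balls, that is, over two independent copies of the
  experiment: on the left \<open>s\<close> satisfies \<open>A\<close> and \<open>B\<close>, on the right \<open>s\<close> satisfies \<open>A\<close> and \<open>t\<close>
  satisfies \<open>B\<close>, and always both satisfy \<open>C\<close>.

  The balls are independent, so the weight of a pair does not change when the positions of any set
  of balls are exchanged between \<open>s\<close> and \<open>t\<close>. It is therefore enough to compare the two sides on
  each orbit of these exchanges. Draw ball \<open>i\<close> as an edge that joins the urns \<open>s i\<close> and \<open>t i\<close>. An
  orbit is a multigraph on the urns, its members are the orientations of that multigraph, and the
  occupancies of \<open>s\<close> and \<open>t\<close> are the outdegrees and the indegrees. On a given multigraph \<open>C\<close> either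
  fails for every orientation or says that each vertex of \<open>S\<close> is balanced, with equal indegree and
  outdegree.

  At a balanced vertex, pair each incoming edge with an outgoing one. The number of such pairings is
  the same for every balanced orientation, so one may sum over the pairings as well. A system of
  pairings at all vertices of \<open>S\<close> decomposes the multigraph into closed trails and trails between
  vertices outside \<open>S\<close>, and these can be oriented independently of each other. Only the trails from
  \<open>J\<close> to \<open>K\<close> matter to both events. An orientation of such a trail that helps \<open>A\<close> in \<open>s\<close> hurts
  \<open>B\<close> in \<open>s\<close> and helps \<open>B\<close> in \<open>t\<close>, so an inequality of Harris type gives the comparison.

  The trails are built by welding one pair of edges at a time. Thus \<open>balanced_orientations\<close> is an
  induction on the number of edges: \<open>sum_loop\<close> removes a loop at \<open>S\<close>, \<open>sum_weld\<close> replaces two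
  edges by one, \<open>card_opposite\<close> shows that the number of possible partners of an edge is constant,
  and \<open>free_orientations\<close> is the base case, where no edge meets \<open>S\<close>. The theorem
  \<open>conditioned_counts\<close> carries out the averaging over exchanges, and \<open>occupancy_law\<close> supplies the
  product weights.
\<close>

section \<open>Orientations of a multigraph\<close>

text \<open>
  The two ends of the edge \<open>e\<close> are \<open>D e True\<close> and \<open>D e False\<close>. A choice \<open>y\<close> of one end of each edge is an
  orientation when the chosen end is read as the tail, and the opposite choice then picks the heads.
  Below, orientations are sets \<open>X\<close> of edges: those with tail \<open>D e True\<close>. A loop counts once in the
  outdegree and once in the indegree of its vertex, for both of its orientations.
\<close>
definition ends :: "'e set \<Rightarrow> ('e \<Rightarrow> bool \<Rightarrow> 'v) \<Rightarrow> ('e \<Rightarrow> bool) \<Rightarrow> 'v \<Rightarrow> nat" where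
  "ends E D y v = (\<Sum>e\<in>E. of_bool (D e (y e) = v))"

abbreviation outdeg :: "'e set \<Rightarrow> ('e \<Rightarrow> bool \<Rightarrow> 'v) \<Rightarrow> 'e set \<Rightarrow> 'v \<Rightarrow> nat" where
  "outdeg E D X \<equiv> ends E D (\<lambda>e. e \<in> X)"

abbreviation indeg :: "'e set \<Rightarrow> ('e \<Rightarrow> bool \<Rightarrow> 'v) \<Rightarrow> 'e set \<Rightarrow> 'v \<Rightarrow> nat" where
  "indeg E D X \<equiv> ends E D (\<lambda>e. e \<notin> X)"

definition balanced :: "'v set \<Rightarrow> 'e set \<Rightarrow> ('e \<Rightarrow> bool \<Rightarrow> 'v) \<Rightarrow> 'e set \<Rightarrow> bool" where
  "balanced S E D X \<longleftrightarrow> (\<forall>v\<in>S. outdeg E D X v = indeg E D X v)"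

definition supported_on :: "'v set \<Rightarrow> (('v \<Rightarrow> nat) \<Rightarrow> real) \<Rightarrow> bool" where
  "supported_on J f \<longleftrightarrow> (\<forall>u w. (\<forall>v\<in>J. u v = w v) \<longrightarrow> f u = f w)"

lemma supported_onD: "supported_on J f \<Longrightarrow> (\<And>v. v \<in> J \<Longrightarrow> u v = w v) \<Longrightarrow> f u = f w"
  unfolding supported_on_def by blast

text \<open>
  The right side minus the left side of the comparison, at one orientation. Letting \<open>g\<close> read the
  indegrees amounts to reading the occupancies of the second placement of the pair.
\<close>
definition gain ::
  "(('v \<Rightarrow> nat) \<Rightarrow> real) \<Rightarrow> (('v \<Rightarrow> nat) \<Rightarrow> real) \<Rightarrow> 'e set \<Rightarrow> ('e \<Rightarrow> bool \<Rightarrow> 'v) \<Rightarrow> 'e set \<Rightarrow> real" where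
  "gain f g E D X = f (outdeg E D X) * (g (indeg E D X) - g (outdeg E D X))"

lemma ends_cong: "(\<And>e. e \<in> E \<Longrightarrow> D e (y e) = D' e (y' e)) \<Longrightarrow> ends E D y = ends E D' y'"
  unfolding ends_def by (rule ext, rule sum.cong) auto

lemma ends_cong_choice: "(\<And>e. e \<in> E \<Longrightarrow> y e = y' e) \<Longrightarrow> ends E D y = ends E D y'"
  by (rule ends_cong) simp

lemma ends_remove:
  "finite E \<Longrightarrow> e \<in> E \<Longrightarrow> ends E D y v = of_bool (D e (y e) = v) + ends (E - {e}) D y v"
  unfolding ends_def by (rule sum.remove)

section \<open>Multigraphs without balance conditions\<close>
lemma sum_Pow_insert:
  fixes \<phi> :: "'a set \<Rightarrow> 'b::comm_monoid_add"
  assumes "finite E" "e \<notin> E"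
  shows "(\<Sum>X\<in>Pow (insert e E). \<phi> X) = (\<Sum>X\<in>Pow E. \<phi> (insert e X) + \<phi> X)"
proof -
  have inj: "inj_on (insert e) (Pow E)"
    using assms(2) by (auto simp: inj_on_def)
  have "(\<Sum>X\<in>Pow (insert e E). \<phi> X) = (\<Sum>X\<in>Pow E. \<phi> X) + (\<Sum>X\<in>insert e ` Pow E. \<phi> X)"
    unfolding Pow_insert using assms by (intro sum.union_disjoint) auto
  also have "(\<Sum>X\<in>insert e ` Pow E. \<phi> X) = (\<Sum>X\<in>Pow E. \<phi> (insert e X))"
    using inj by (simp add: sum.reindex)
  finally show ?thesis by (simp add: sum.distrib add.commute)
qed

definition bump :: "'v \<Rightarrow> ('v \<Rightarrow> nat) \<Rightarrow> 'v \<Rightarrow> nat" where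
  "bump p u = u(p := Suc (u p))"

lemma ends_insert:
  assumes "finite E" "e \<notin> E"
  shows "ends (insert e E) D y = bump (D e (y e)) (ends E D y)"
  using assms by (auto simp: ends_def bump_def fun_eq_iff)

lemma mono_bump: "mono f \<Longrightarrow> mono (\<lambda>u. f (bump p u))"
  by (auto simp: mono_def le_fun_def bump_def)

lemma supported_on_bump: "supported_on J f \<Longrightarrow> supported_on J (\<lambda>u. f (bump p u))"
  unfolding supported_on_def bump_def by simp

lemma bump_ge: "mono f \<Longrightarrow> f u \<le> f (bump p u)" for f :: "('v \<Rightarrow> nat) \<Rightarrow> real"
  by (auto simp: mono_def le_fun_def bump_def)

lemma bump_outside: "supported_on J f \<Longrightarrow> p \<notin> J \<Longrightarrow> f (bump p u) = f u"
  by (auto simp: bump_def intro: supported_onD)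

text \<open>
  The functions \<open>f\<close> and \<open>g\<close> disagree about which of the vertices \<open>p\<close> and \<open>q\<close> should receive an
  additional unit: a vertex whose unit increases \<open>f\<close> lies in \<open>J\<close>, so it leaves \<open>g\<close> alone.
  Hence the increments of \<open>f\<close> and \<open>g\<close> under exchange of \<open>p\<close> and \<open>q\<close> have opposite signs, whatever
  the points \<open>u\<close> and \<open>w\<close> are.
\<close>
lemma bump_opposite:
  assumes "mono f" "mono g" "supported_on J f" "supported_on K g" "J \<inter> K = {}"
  shows "f (bump p u) * g (bump p w) + f (bump q u) * g (bump q w)
       \<le> f (bump p u) * g (bump q w) + f (bump q u) * g (bump p w)"
proof -
  have "(f (bump p u) - f (bump q u)) * (g (bump p w) - g (bump q w)) \<le> 0"
  proof (cases "p \<in> J"; cases "q \<in> J")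
    assume "p \<in> J" "q \<in> J"
    hence "p \<notin> K" "q \<notin> K" using assms(5) by auto
    thus ?thesis using assms by (simp add: bump_outside)
  next
    assume "p \<in> J" "q \<notin> J"
    hence "p \<notin> K" using assms(5) by auto
    thus ?thesis using assms \<open>q \<notin> J\<close> bump_ge[of f u p] bump_ge[of g w q]
      by (simp add: bump_outside mult_nonneg_nonpos)
  next
    assume "p \<notin> J" "q \<in> J"
    hence "q \<notin> K" using assms(5) by auto
    thus ?thesis using assms \<open>p \<notin> J\<close> bump_ge[of f u q] bump_ge[of g w p]
      by (simp add: bump_outside mult_nonpos_nonneg)
  next
    assume "p \<notin> J" "q \<notin> J"
    thus ?thesis using assms by (simp add: bump_outside)
  qed
  thus ?thesis by (simp add: algebra_simps)
qed

text \<open>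
  All orientations are admitted, so the edges are independent and can be added one at a time. An
  additional edge from \<open>p\<close> to \<open>q\<close> shifts the arguments of \<open>f\<close> and \<open>g\<close>. By \<open>bump_opposite\<close>, moving
  the shift of \<open>g\<close> to the opposite end is favourable, which leaves the induction hypothesis for the
  pair shifted at \<open>p\<close> and for the pair shifted at \<open>q\<close>.
\<close>
lemma free_orientations:
  assumes "finite E" "mono f" "mono g" "supported_on J f" "supported_on K g" "J \<inter> K = {}"
  shows "0 \<le> (\<Sum>X\<in>Pow E. gain f g E D X)"
  using assms
proof (induction E arbitrary: f g rule: finite_induct)
  case empty
  have "ends {} D y = (\<lambda>_. 0)" for y by (simp add: ends_def fun_eq_iff)
  thus ?case by (simp add: gain_def)
next
  case (insert e E)
  let ?p = "D e True" and ?q = "D e False"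
  let ?b = "\<lambda>p f u. f (bump p u)"
  have split: "gain (?b ?p f) (?b ?p g) E D X + gain (?b ?q f) (?b ?q g) E D X
      \<le> gain f g (insert e E) D (insert e X) + gain f g (insert e E) D X" if "X \<in> Pow E" for X
  proof -
    have e: "e \<notin> X" using that insert.hyps by auto
    have "ends E D (\<lambda>x. x = e \<or> x \<in> X) = outdeg E D X" "ends E D (\<lambda>x. x \<noteq> e \<and> x \<notin> X) = indeg E D X"
      using insert.hyps by (auto intro!: ends_cong_choice)
    thus ?thesis
      using bump_opposite[OF insert.prems, where p = ?p and q = ?q and u = "outdeg E D X" and w = "indeg E D X"] e insert.hyps
      by (simp add: gain_def ends_insert algebra_simps)
  qed
  have "0 \<le> (\<Sum>X\<in>Pow E. gain (?b ?p f) (?b ?p g) E D X) + (\<Sum>X\<in>Pow E. gain (?b ?q f) (?b ?q g) E D X)"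
    by (intro add_nonneg_nonneg insert.IH mono_bump supported_on_bump insert.prems)
  also have "\<dots> \<le> (\<Sum>X\<in>Pow E. gain f g (insert e E) D (insert e X) + gain f g (insert e E) D X)"
    unfolding sum.distrib[symmetric] by (intro sum_mono split)
  also have "\<dots> = (\<Sum>X\<in>Pow (insert e E). gain f g (insert e E) D X)"
    using insert.hyps by (simp add: sum_Pow_insert)
  finally show ?case .
qed

section \<open>Removing loops and welding edges\<close>
lemma gain_away_from:
  assumes "\<And>v. v \<noteq> s \<Longrightarrow> outdeg E D X v = outdeg E' D' X' v"
    and "\<And>v. v \<noteq> s \<Longrightarrow> indeg E D X v = indeg E' D' X' v"
    and "supported_on J f" "supported_on K g" "s \<notin> J" "s \<notin> K"
  shows "gain f g E D X = gain f g E' D' X'"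
proof -
  have "f (outdeg E D X) = f (outdeg E' D' X')"
    using assms(3) by (rule supported_onD) (metis assms)
  moreover have "g (outdeg E D X) = g (outdeg E' D' X')"
    using assms(4) by (rule supported_onD) (metis assms)
  moreover have "g (indeg E D X) = g (indeg E' D' X')"
    using assms(4) by (rule supported_onD) (metis assms)
  ultimately show ?thesis by (simp add: gain_def)
qed

text \<open>
  If the ends \<open>D e b\<close> and \<open>D e' b'\<close> are the same vertex, then \<open>e\<close> and \<open>e'\<close> form a path through it. The
  welded edge keeps the name \<open>e\<close> and joins the two outer ends of this path, and \<open>e'\<close> is dropped.
  The end \<open>b\<close> of the welded edge is the outer end of \<open>e'\<close>: if \<open>e\<close> leaves the middle vertex, then the
  path runs from the outer end of \<open>e'\<close> to the outer end of \<open>e\<close>. So membership of \<open>e\<close> in an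
  orientation has a consistent meaning before and after welding.
\<close>
definition weld :: "('e \<Rightarrow> bool \<Rightarrow> 'v) \<Rightarrow> 'e \<Rightarrow> bool \<Rightarrow> 'e \<Rightarrow> bool \<Rightarrow> 'e \<Rightarrow> bool \<Rightarrow> 'v" where
  "weld D e b e' b' = D(e := \<lambda>c. if c = b then D e' (\<not> b') else D e c)"

text \<open>
  Under the last hypothesis the choice takes exactly one of the two edge ends at \<open>s\<close>, so the path is
  consistently directed. Welding then only loses the contribution of the middle vertex \<open>s\<close>. The
  hypothesis is symmetric under reversal, so this serves for outdegrees and for indegrees.
\<close>
lemma ends_weld:
  assumes "finite E" "e \<in> E" "e' \<in> E" "e \<noteq> e'" "D e b = s" "D e' b' = s"
    and "(y e = b) \<noteq> (y e' = b')"
  shows "ends E D y v = ends (E - {e'}) (weld D e b e' b') y v + of_bool (v = s)"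
proof -
  have "ends E D y v = of_bool (D e' (y e') = v) + (of_bool (D e (y e) = v) + ends (E - {e'} - {e}) D y v)"
    using assms by (simp add: ends_remove[of E e'] ends_remove[of "E - {e'}" e])
  moreover have "ends (E - {e'}) (weld D e b e' b') y v =
      of_bool (weld D e b e' b' e (y e) = v) + ends (E - {e'} - {e}) (weld D e b e' b') y v"
    using assms by (simp add: ends_remove[of "E - {e'}" e])
  moreover have "ends (E - {e'} - {e}) (weld D e b e' b') y = ends (E - {e'} - {e}) D y"
    by (rule ends_cong) (auto simp: weld_def)
  moreover have "of_bool (D e' (y e') = v) + of_bool (D e (y e) = v)
      = of_bool (weld D e b e' b' e (y e) = v) + (of_bool (v = s) :: nat)"
    using assms(5-7) by (cases b; cases b'; cases "y e"; cases "y e'") (auto simp: weld_def)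
  ultimately show ?thesis by simp
qed

text \<open>
  Orientations in which \<open>e\<close> and \<open>e'\<close> pass through \<open>s\<close> correspond bijectively to orientations of the
  welded multigraph. Welding lowers the indegree and the outdegree of \<open>s\<close> by one, so it preserves
  balance, and \<open>f\<close> and \<open>g\<close> do not look at \<open>s\<close>.
\<close>
lemma sum_weld:
  assumes "finite E" "e \<in> E" "e' \<in> E" "e \<noteq> e'" "D e b = s" "D e' b' = s"
    and "supported_on J f" "supported_on K g" "s \<notin> J" "s \<notin> K"
  shows "(\<Sum>X | X \<subseteq> E \<and> balanced S E D X \<and> (e \<in> X \<longleftrightarrow> b) \<noteq> (e' \<in> X \<longleftrightarrow> b'). gain f g E D X)
    = (\<Sum>X | X \<subseteq> E - {e'} \<and> balanced S (E - {e'}) (weld D e b e' b') X.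
        gain f g (E - {e'}) (weld D e b e' b') X)"
    (is "sum _ ?L = sum _ ?R")
proof -
  define D' where "D' = weld D e b e' b'"
  \<comment> \<open>The direction of \<open>e'\<close> is recovered from that of \<open>e\<close>, to which it is opposite at \<open>s\<close>.\<close>
  define up where "up X = (if ((e \<in> X \<longleftrightarrow> b) \<longleftrightarrow> b') then X else insert e' X)" for X
  have out: "outdeg E D X v = outdeg (E - {e'}) D' (X - {e'}) v + of_bool (v = s)"
    and inn: "indeg E D X v = indeg (E - {e'}) D' (X - {e'}) v + of_bool (v = s)"
    if "(e \<in> X \<longleftrightarrow> b) \<noteq> (e' \<in> X \<longleftrightarrow> b')" for X v
  proof -
    have "outdeg (E - {e'}) D' (X - {e'}) = outdeg (E - {e'}) D' X"
      "indeg (E - {e'}) D' (X - {e'}) = indeg (E - {e'}) D' X"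
      by (auto intro!: ends_cong_choice)
    moreover have "outdeg E D X v = outdeg (E - {e'}) D' X v + of_bool (v = s)"
      unfolding D'_def using assms that by (intro ends_weld) auto
    moreover have "indeg E D X v = indeg (E - {e'}) D' X v + of_bool (v = s)"
      unfolding D'_def using assms that by (intro ends_weld) auto
    ultimately show "outdeg E D X v = outdeg (E - {e'}) D' (X - {e'}) v + of_bool (v = s)"
      "indeg E D X v = indeg (E - {e'}) D' (X - {e'}) v + of_bool (v = s)" by simp_all
  qed
  have bal: "balanced S E D X \<longleftrightarrow> balanced S (E - {e'}) D' (X - {e'})"
    if "(e \<in> X \<longleftrightarrow> b) \<noteq> (e' \<in> X \<longleftrightarrow> b')" for X
    unfolding balanced_def using out[OF that] inn[OF that] by simp
  have gain: "gain f g (E - {e'}) D' (X - {e'}) = gain f g E D X"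
    if "(e \<in> X \<longleftrightarrow> b) \<noteq> (e' \<in> X \<longleftrightarrow> b')" for X
    by (rule gain_away_from[symmetric, of s _ _ _ _ _ _ J _ K])
      (use assms(7-10) out[OF that] inn[OF that] in auto)
  have up: "(e \<in> up X \<longleftrightarrow> b) \<noteq> (e' \<in> up X \<longleftrightarrow> b')" "up X - {e'} = X" if "X \<subseteq> E - {e'}" for X
    using that assms(4) unfolding up_def by auto
  show ?thesis
    unfolding D'_def[symmetric]
  proof (rule sum.reindex_bij_witness[where i = up and j = "\<lambda>X. X - {e'}"])
    fix X assume X: "X \<in> ?L"
    show "up (X - {e'}) = X" using X assms(4) unfolding up_def by auto
    show "X - {e'} \<in> {X. X \<subseteq> E - {e'} \<and> balanced S (E - {e'}) D' X}"
      using X bal[of X] by auto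
    show "gain f g (E - {e'}) D' (X - {e'}) = gain f g E D X" using X gain by auto
  next
    fix X assume X: "X \<in> {X. X \<subseteq> E - {e'} \<and> balanced S (E - {e'}) D' X}"
    show "up X - {e'} = X" using X up by auto
    show "up X \<in> ?L"
      using X up[of X] bal[of "up X"] assms(3) unfolding up_def by (auto split: if_splits)
  qed
qed

lemma sum_loop:
  assumes "finite E" "e \<in> E" "D e True = s" "D e False = s"
    and "supported_on J f" "supported_on K g" "s \<notin> J" "s \<notin> K"
  shows "(\<Sum>X | X \<subseteq> E \<and> balanced S E D X. gain f g E D X)
    = 2 * (\<Sum>X | X \<subseteq> E - {e} \<and> balanced S (E - {e}) D X. gain f g (E - {e}) D X)"
proof -
  define F where "F = E - {e}"
  have F: "finite F" "e \<notin> F" "E = insert e F" using assms by (auto simp: F_def)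
  have D: "D e c = s" for c using assms by (cases c) auto
  let ?\<phi> = "\<lambda>E X. if balanced S E D X then gain f g E D X else 0"
  have step: "?\<phi> E X = ?\<phi> F (X - {e})" for X
  proof -
    have "outdeg F D (X - {e}) = outdeg F D X" "indeg F D (X - {e}) = indeg F D X"
      using F by (auto intro!: ends_cong_choice)
    hence eq: "outdeg E D X v = outdeg F D (X - {e}) v + of_bool (v = s)"
       "indeg E D X v = indeg F D (X - {e}) v + of_bool (v = s)" for v
      using F D by (auto simp: ends_insert bump_def)
    have "balanced S E D X = balanced S F D (X - {e})"
      by (simp add: balanced_def eq)
    moreover have "gain f g E D X = gain f g F D (X - {e})"
      by (rule gain_away_from[of s _ _ _ _ _ _ J _ K]) (use assms(5-8) eq in auto)
    ultimately show ?thesis by simp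
  qed
  have conv: "(\<Sum>X | X \<subseteq> E \<and> balanced S E D X. gain f g E D X) = (\<Sum>X\<in>Pow E. ?\<phi> E X)"
    if "finite E" for E
    using that by (subst sum.inter_filter[symmetric]) (auto simp: Pow_def)
  have "(\<Sum>X\<in>Pow E. ?\<phi> E X) = (\<Sum>X\<in>Pow (insert e F). ?\<phi> F (X - {e}))"
    using F(3) step by (simp only:)
  also have "\<dots> = (\<Sum>X\<in>Pow F. ?\<phi> F (insert e X - {e}) + ?\<phi> F (X - {e}))"
    by (rule sum_Pow_insert) (use F in auto)
  also have "\<dots> = (\<Sum>X\<in>Pow F. 2 * ?\<phi> F X)"
  proof (rule sum.cong[OF refl])
    fix X assume "X \<in> Pow F"
    hence "X - {e} = X" "insert e X - {e} = X" using F by auto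
    thus "?\<phi> F (insert e X - {e}) + ?\<phi> F (X - {e}) = 2 * ?\<phi> F X" by simp
  qed
  finally have "(\<Sum>X\<in>Pow E. ?\<phi> E X) = 2 * (\<Sum>X\<in>Pow F. ?\<phi> F X)"
    by (simp only: sum_distrib_left)
  thus ?thesis unfolding conv[OF assms(1)] conv[OF F(1)[unfolded F_def]] F_def .
qed

section \<open>Multigraphs with balanced vertices\<close>
lemma degree_eq:
  "outdeg E D X v + indeg E D X v = ends E D (\<lambda>_. True) v + ends E D (\<lambda>_. False) v"
  unfolding ends_def sum.distrib[symmetric]
proof (rule sum.cong[OF refl])
  fix e
  show "of_bool (D e (e \<in> X) = v) + of_bool (D e (e \<notin> X) = v) =
      (of_bool (D e True = v) + of_bool (D e False = v) :: nat)"
    by (cases "e \<in> X") simp_all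
qed

text \<open>
  The pairs counted here are the edge ends at \<open>s\<close> that can be paired with the end \<open>b\<close> of \<open>e\<close>, that
  is, those on the opposite side of \<open>s\<close> in the orientation. By balance there are as many on either
  side, namely half the degree of \<open>s\<close>, which does not depend on the orientation.
\<close>
lemma card_opposite:
  assumes "finite E" "e \<in> E" "D e b = s" "D e (\<not> b) \<noteq> s"
    and "outdeg E D X s = indeg E D X s"
  shows "card {(e', b'). e' \<in> E \<and> e' \<noteq> e \<and> D e' b' = s \<and> (e \<in> X \<longleftrightarrow> b) \<noteq> (e' \<in> X \<longleftrightarrow> b')}
    = outdeg E D X s" (is "card ?P = _")
proof -
  \<comment> \<open>True if \<open>e\<close> leaves \<open>s\<close>; an opposite end is then a head, and otherwise a tail.\<close>
  define c where "c = (e \<in> X \<longleftrightarrow> b)"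
  have "?P = (\<lambda>e'. (e', (e' \<in> X) \<noteq> c)) ` {e' \<in> E. D e' ((e' \<in> X) \<noteq> c) = s}"
  proof -
    have "e' \<noteq> e" if "D e' ((e' \<in> X) \<noteq> c) = s" for e'
      using that assms(3,4) unfolding c_def by (cases b; cases "e \<in> X") auto
    thus ?thesis unfolding c_def[symmetric] by auto
  qed
  hence "card ?P = card {e' \<in> E. D e' ((e' \<in> X) \<noteq> c) = s}"
    by (simp add: card_image inj_on_def)
  also have "\<dots> = ends E D (\<lambda>e'. (e' \<in> X) \<noteq> c) s"
    using assms(1) by (simp add: ends_def Int_def)
  also have "\<dots> = outdeg E D X s"
    using assms(5) by (cases c) auto
  finally show ?thesis .
qed

text \<open>
  This is the decomposition into trails, carried out one pair of edges at a time. If an edge \<open>e\<close> that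
  is not a loop ends at \<open>s \<in> S\<close>, then every balanced orientation offers the same number of partners for
  this end, so the sum over balanced orientations is a positive multiple of the sum over partners of
  the sums over orientations compatible with that pairing. Each of the latter belongs to a welded
  multigraph with fewer edges. A loop at \<open>s\<close> has no use for a partner, since its own ends are
  opposite to each other. It is removed instead, because its direction has no influence.
\<close>
theorem balanced_orientations:
  assumes "finite E" "mono f" "mono g" "supported_on J f" "supported_on K g"
    and "J \<inter> K = {}" "S \<inter> J = {}" "S \<inter> K = {}"
  shows "0 \<le> (\<Sum>X | X \<subseteq> E \<and> balanced S E D X. gain f g E D X)"
  using assms(1)
proof (induction "card E" arbitrary: E D rule: less_induct)
  case less
  have smaller: "card (E - {e}) < card E" "finite (E - {e})" if "e \<in> E" for e
    using that less.prems by (simp_all only: card_Diff1_less finite_Diff)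
  consider (loop) e s where "e \<in> E" "s \<in> S" "D e True = s" "D e False = s"
    | (path) e b s where "e \<in> E" "s \<in> S" "D e b = s" "D e (\<not> b) \<noteq> s"
    | (free) "\<And>e b. e \<in> E \<Longrightarrow> D e b \<notin> S"
  proof (cases "\<exists>e\<in>E. \<exists>b. D e b \<in> S")
    case True
    then obtain e b where eb: "e \<in> E" "D e b \<in> S" by blast
    show thesis
    proof (cases "D e (\<not> b) = D e b")
      case True
      hence "D e True = D e b" "D e False = D e b" by (cases b; simp)+
      with eb show thesis by (rule loop)
    next
      case False
      with eb show thesis using path[OF _ _ refl] by blast
    qed
  next
    case False
    thus thesis using free by blast
  qed
  thus ?case
  proof cases
    case loop
    have "s \<notin> J" "s \<notin> K" using loop assms by auto
    hence "(\<Sum>X | X \<subseteq> E \<and> balanced S E D X. gain f g E D X)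
      = 2 * (\<Sum>X | X \<subseteq> E - {e} \<and> balanced S (E - {e}) D X. gain f g (E - {e}) D X)"
      using less.prems loop assms(4,5) by (intro sum_loop)
    moreover have "0 \<le> (\<Sum>X | X \<subseteq> E - {e} \<and> balanced S (E - {e}) D X. gain f g (E - {e}) D X)"
      using smaller[OF loop(1)] by (rule less.hyps)
    ultimately show ?thesis by simp
  next
    case path
    have s: "s \<notin> J" "s \<notin> K" using path assms by auto
    define P where "P = {(e', b'). e' \<in> E \<and> e' \<noteq> e \<and> D e' b' = s}"
    define opp where "opp X p \<longleftrightarrow> (e \<in> X \<longleftrightarrow> b) \<noteq> (fst p \<in> X \<longleftrightarrow> snd p)" for X p
    define B where "B = {X. X \<subseteq> E \<and> balanced S E D X}"
    define d where "d = ends E D (\<lambda>_. True) s + ends E D (\<lambda>_. False) s"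
    have finP: "finite P"
      by (rule finite_subset[of _ "E \<times> UNIV"]) (use less.prems in \<open>auto simp: P_def\<close>)
    have finB: "finite B" using less.prems by (simp add: B_def)
    have "d > 0"
    proof -
      have "ends E D (\<lambda>_. b) s > 0"
        using less.prems path by (subst ends_remove[of E e]) auto
      thus ?thesis by (cases b) (auto simp: d_def)
    qed
    have nonneg: "0 \<le> (\<Sum>X | X \<in> B \<and> opp X p. gain f g E D X)" if pP: "p \<in> P" for p
    proof -
      obtain e' b' where p: "p = (e', b')" "e' \<in> E" "e' \<noteq> e" "D e' b' = s"
        using pP by (auto simp: P_def)
      have "(\<Sum>X | X \<in> B \<and> opp X p. gain f g E D X) =
          (\<Sum>X | X \<subseteq> E \<and> balanced S E D X \<and> (e \<in> X \<longleftrightarrow> b) \<noteq> (e' \<in> X \<longleftrightarrow> b'). gain f g E D X)"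
        by (rule sum.cong) (auto simp: B_def opp_def p)
      also have "\<dots> = (\<Sum>X | X \<subseteq> E - {e'} \<and> balanced S (E - {e'}) (weld D e b e' b') X.
        gain f g (E - {e'}) (weld D e b e' b') X)"
        using less.prems path(1) p(2) p(3)[symmetric] path(3) p(4) assms(4,5) s by (rule sum_weld)
      also have "\<dots> \<ge> 0" by (rule less.hyps[OF smaller[OF p(2)]])
      finally show ?thesis .
    qed
    \<comment> \<open>The factor 2 appears because a balanced orientation has \<open>d / 2\<close> opposite ends at \<open>s\<close>.\<close>
    have count: "real d * gain f g E D X = 2 * (\<Sum>p | p \<in> P \<and> opp X p. gain f g E D X)" if "X \<in> B" for X
    proof -
      have eq: "outdeg E D X s = indeg E D X s" using that path by (auto simp: B_def balanced_def)
      have "{p. p \<in> P \<and> opp X p} = {(e', b'). e' \<in> E \<and> e' \<noteq> e \<and> D e' b' = s \<and> (e \<in> X \<longleftrightarrow> b) \<noteq> (e' \<in> X \<longleftrightarrow> b')}"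
        by (auto simp: P_def opp_def)
      hence "card {p. p \<in> P \<and> opp X p} = outdeg E D X s"
        using card_opposite[OF less.prems path(1,3,4) eq] by simp
      moreover have "d = 2 * outdeg E D X s"
        using degree_eq[of E D X s] eq by (simp add: d_def)
      ultimately show ?thesis by simp
    qed
    have "real d * (\<Sum>X\<in>B. gain f g E D X) = (\<Sum>X\<in>B. 2 * (\<Sum>p | p \<in> P \<and> opp X p. gain f g E D X))"
      by (simp add: sum_distrib_left count)
    also have "\<dots> = 2 * (\<Sum>p\<in>P. \<Sum>X | X \<in> B \<and> opp X p. gain f g E D X)"
      using sum.swap_restrict[OF finB finP, of "\<lambda>X p. gain f g E D X" opp]
      by (simp add: sum_distrib_left[symmetric])
    also have "\<dots> \<ge> 0" by (intro mult_nonneg_nonneg sum_nonneg nonneg) auto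
    finally have "0 \<le> (\<Sum>X\<in>B. gain f g E D X)"
      using \<open>d > 0\<close> by (simp add: zero_le_mult_iff)
    thus ?thesis by (simp add: B_def)
  next
    case free
    have "ends E D y v = 0" if "v \<in> S" for y v
      using free that less.prems by (auto simp: ends_def)
    hence "{X. X \<subseteq> E \<and> balanced S E D X} = Pow E" by (auto simp: balanced_def)
    thus ?thesis using free_orientations[of E f g J K D] assms less.prems by simp
  qed
qed

section \<open>Exchanging balls between two placements\<close>
definition counts :: "'i set \<Rightarrow> ('i \<Rightarrow> 'v) \<Rightarrow> 'v \<Rightarrow> nat" where
  "counts I s v = (\<Sum>i\<in>I. of_bool (s i = v))"

definition swap_on :: "'i set \<Rightarrow> 'i set \<Rightarrow> ('i \<Rightarrow> 'v) \<times> ('i \<Rightarrow> 'v) \<Rightarrow> ('i \<Rightarrow> 'v) \<times> ('i \<Rightarrow> 'v)" where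
  "swap_on I X = (\<lambda>(s, t). (\<lambda>i\<in>I. if i \<in> X then s i else t i, \<lambda>i\<in>I. if i \<in> X then t i else s i))"

lemma swap_on_PiE:
  assumes "q \<in> (I \<rightarrow>\<^sub>E V) \<times> (I \<rightarrow>\<^sub>E V)"
  shows "swap_on I X q \<in> (I \<rightarrow>\<^sub>E V) \<times> (I \<rightarrow>\<^sub>E V)" "swap_on I X (swap_on I X q) = q"
  using assms by (auto simp: swap_on_def PiE_def extensional_def fun_eq_iff Pi_def)

text \<open>
  The inequality for arbitrary product weights, before normalisation. The difference of its two sides
  is a sum over pairs \<open>(s, t)\<close>. This sum is averaged over all \<open>2 ^ card I\<close> exchanges, and for each
  pair the average is a nonnegative weight times the sum treated in \<open>balanced_orientations\<close>, taken
  over the multigraph with the edges \<open>s i\<close> -- \<open>t i\<close>.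
\<close>
theorem conditioned_counts:
  fixes p :: "'i \<Rightarrow> 'v \<Rightarrow> real" and a :: "'v \<Rightarrow> nat" and V :: "'v set"
  assumes "finite I" "\<And>i v. 0 \<le> p i v"
    and "mono f" "mono g" "supported_on J f" "supported_on K g"
    and "J \<inter> K = {}" "S \<inter> J = {}" "S \<inter> K = {}"
  defines "w s \<equiv> of_bool (\<forall>v\<in>S. counts I s v = a v) * (\<Prod>i\<in>I. p i (s i))"
  defines "F \<equiv> I \<rightarrow>\<^sub>E V"
  shows "(\<Sum>s\<in>F. w s * (f (counts I s) * g (counts I s))) * (\<Sum>s\<in>F. w s)
    \<le> (\<Sum>s\<in>F. w s * f (counts I s)) * (\<Sum>s\<in>F. w s * g (counts I s))"
proof -
  define \<Phi> where "\<Phi> = (\<lambda>(s, t). w s * w t * (f (counts I s) * (g (counts I t) - g (counts I s))))"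
  define D where "D s t i c = (if c then s i else t i)" for s t :: "'i \<Rightarrow> 'v" and i c
  define W where "W s t = of_bool (\<forall>v\<in>S. counts I s v + counts I t v = 2 * a v) *
      ((\<Prod>i\<in>I. p i (s i)) * (\<Prod>i\<in>I. p i (t i)))" for s t
  have swapped: "\<Phi> (swap_on I X (s, t)) =
      W s t * (of_bool (balanced S I (D s t) X) * gain f g I (D s t) X)" for X s t
  proof -
    define s' t' where "s' = fst (swap_on I X (s, t))" and "t' = snd (swap_on I X (s, t))"
    have s't': "s' i = (if i \<in> X then s i else t i)" "t' i = (if i \<in> X then t i else s i)"
      if "i \<in> I" for i
      using that by (simp_all add: s'_def t'_def swap_on_def)
    have out: "counts I s' = outdeg I (D s t) X" and inn: "counts I t' = indeg I (D s t) X"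
      unfolding counts_def ends_def by (auto simp: D_def s't' intro!: ext sum.cong)
    have total: "counts I s' v + counts I t' v = counts I s v + counts I t v" for v
      unfolding counts_def sum.distrib[symmetric] by (rule sum.cong) (auto simp: s't')
    have "(\<Prod>i\<in>I. p i (s' i)) * (\<Prod>i\<in>I. p i (t' i)) = (\<Prod>i\<in>I. p i (s i)) * (\<Prod>i\<in>I. p i (t i))"
      unfolding prod.distrib[symmetric] by (rule prod.cong) (auto simp: s't')
    \<comment> \<open>The conditions on both placements split into one on the degrees, which all exchanges
      preserve, and the balance condition.\<close>
    moreover have "(\<forall>v\<in>S. counts I s' v = a v) \<and> (\<forall>v\<in>S. counts I t' v = a v) \<longleftrightarrow>
        (\<forall>v\<in>S. counts I s v + counts I t v = 2 * a v) \<and> balanced S I (D s t) X"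
      unfolding balanced_def out[symmetric] inn[symmetric] total[symmetric] by force
    ultimately have "w s' * w t' = W s t * of_bool (balanced S I (D s t) X)"
      by (auto simp: w_def W_def)
    moreover have "swap_on I X (s, t) = (s', t')" by (simp add: s'_def t'_def)
    ultimately show ?thesis by (simp add: \<Phi>_def gain_def out inn)
  qed
  have nonneg: "0 \<le> (\<Sum>X\<in>Pow I. \<Phi> (swap_on I X q))" for q
  proof -
    obtain s t where q: "q = (s, t)" by (cases q)
    have "(\<Sum>X\<in>Pow I. \<Phi> (swap_on I X q)) =
        W s t * (\<Sum>X\<in>Pow I. if balanced S I (D s t) X then gain f g I (D s t) X else 0)"
      unfolding q swapped sum_distrib_left by (rule sum.cong) auto
    also have "(\<Sum>X\<in>Pow I. if balanced S I (D s t) X then gain f g I (D s t) X else 0) =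
        (\<Sum>X | X \<subseteq> I \<and> balanced S I (D s t) X. gain f g I (D s t) X)"
      using assms(1) by (subst sum.inter_filter[symmetric]) (auto simp: Pow_def)
    also have "W s t * \<dots> \<ge> 0"
    proof (rule mult_nonneg_nonneg)
      show "0 \<le> W s t"
        unfolding W_def using assms(2) by (intro mult_nonneg_nonneg prod_nonneg) auto
    qed (rule balanced_orientations[OF assms(1,3-9)])
    finally show ?thesis .
  qed
  have "2 ^ card I * (\<Sum>q\<in>F \<times> F. \<Phi> q) = (\<Sum>X\<in>Pow I. \<Sum>q\<in>F \<times> F. \<Phi> q)"
    using assms(1) by (simp add: card_Pow)
  also have "\<dots> = (\<Sum>X\<in>Pow I. \<Sum>q\<in>F \<times> F. \<Phi> (swap_on I X q))"
  proof (rule sum.cong[OF refl])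
    fix X
    show "(\<Sum>q\<in>F \<times> F. \<Phi> q) = (\<Sum>q\<in>F \<times> F. \<Phi> (swap_on I X q))"
      unfolding F_def
      by (rule sum.reindex_bij_witness[where i = "swap_on I X" and j = "swap_on I X"])
        (simp_all only: swap_on_PiE)
  qed
  also have "\<dots> = (\<Sum>q\<in>F \<times> F. \<Sum>X\<in>Pow I. \<Phi> (swap_on I X q))"
    by (rule sum.swap)
  also have "\<dots> \<ge> 0" by (intro sum_nonneg nonneg)
  finally have "0 \<le> (\<Sum>q\<in>F \<times> F. \<Phi> q)" by (simp add: zero_le_mult_iff power_le_zero_eq)
  also have "\<dots> = (\<Sum>s\<in>F. \<Sum>t\<in>F. w s * f (counts I s) * (w t * g (counts I t))
      - w s * (f (counts I s) * g (counts I s)) * w t)"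
    unfolding \<Phi>_def sum.cartesian_product by (rule sum.cong) (auto simp: algebra_simps)
  also have "\<dots> = (\<Sum>s\<in>F. w s * f (counts I s)) * (\<Sum>s\<in>F. w s * g (counts I s))
      - (\<Sum>s\<in>F. w s * (f (counts I s) * g (counts I s))) * (\<Sum>s\<in>F. w s)"
    by (simp add: sum_subtractf sum_product)
  finally show ?thesis by simp
qed

section \<open>Increasing events as monotone functions\<close>
lemma occupancy_eq_counts: "occupancy m n s = restrict (counts {1..m} s) {1..n}"
  by (auto simp: occupancy_def counts_def fun_eq_iff Int_def)

lemma occupancy_in_Nvec: "occupancy m n s \<in> Nvec n"
  by (simp add: occupancy_def Nvec_def)

lemma not_affectsD:
  assumes "\<not> affects n j A" "x \<in> A" "y \<in> Nvec n" "\<forall>i\<in>{1..n} - {j}. x i = y i"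
  shows "y \<in> A"
  using assms unfolding affects_def by blast

text \<open>
  Pass from \<open>x\<close> to \<open>y\<close> by changing one coordinate at a time. A coordinate that changes does not affect
  \<open>A\<close>, so no step leaves \<open>A\<close>.
\<close>
lemma event_determined_by_affecting:
  assumes "x \<in> A" "x \<in> Nvec n" "y \<in> Nvec n"
    and agree: "\<And>j. j \<in> {1..n} \<Longrightarrow> affects n j A \<Longrightarrow> x j = y j"
  shows "y \<in> A"
proof -
  define z where "z T = (\<lambda>j. if j \<in> T then y j else x j)" for T
  have z_Nvec: "z T \<in> Nvec n" for T
    using assms(2,3) by (auto simp: z_def Nvec_def PiE_iff extensional_def)
  have "z T \<in> A" if "finite T" "T \<subseteq> {1..n}" for T
    using that
  proof (induction T rule: finite_induct)
    case empty
    have "z {} = x" by (simp add: z_def)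
    thus ?case using assms(1) by simp
  next
    case (insert j T)
    hence "z T \<in> A" by simp
    show ?case
    proof (cases "affects n j A")
      case True
      hence "z (insert j T) = z T" using agree[of j] insert.prems by (auto simp: z_def fun_eq_iff)
      thus ?thesis using \<open>z T \<in> A\<close> by simp
    next
      case False
      have "\<forall>i\<in>{1..n} - {j}. z T i = z (insert j T) i" by (simp add: z_def)
      thus ?thesis by (rule not_affectsD[OF False \<open>z T \<in> A\<close> z_Nvec])
    qed
  qed
  hence "z {1..n} \<in> A" by simp
  moreover have "z {1..n} = y"
    using assms(2,3) by (auto simp: z_def Nvec_def PiE_iff extensional_def fun_eq_iff)
  ultimately show ?thesis by simp
qed

text \<open>
  The indicator of \<open>A\<close> with the coordinates in \<open>S\<close> overwritten by \<open>a\<close>. On the conditioning event it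
  agrees with the indicator of \<open>A\<close>, but it ignores the coordinates in \<open>S\<close>, as
  \<open>conditioned_counts\<close> demands. An event may well be affected by coordinates in \<open>S\<close>.
\<close>
definition pinned :: "nat \<Rightarrow> nat set \<Rightarrow> (nat \<Rightarrow> nat) \<Rightarrow> (nat \<Rightarrow> nat) set \<Rightarrow> (nat \<Rightarrow> nat) \<Rightarrow> real" where
  "pinned n S a A u = indicator A (\<lambda>j\<in>{1..n}. if j \<in> S then a j else u j)"

lemma mono_pinned: "increasing_event n A \<Longrightarrow> mono (pinned n S a A)"
proof (rule monoI)
  fix u w :: "nat \<Rightarrow> nat"
  assume A: "increasing_event n A" and "u \<le> w"
  let ?r = "\<lambda>u. \<lambda>j\<in>{1..n}. if j \<in> S then a j else u j"
  have "?r w \<in> Nvec n" "\<forall>j\<in>{1..n}. ?r u j \<le> ?r w j"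
    using \<open>u \<le> w\<close> by (auto simp: Nvec_def le_fun_def)
  hence "?r w \<in> A" if "?r u \<in> A"
    using A that unfolding increasing_event_def by (elim conjE) (drule (1) bspec, drule (1) bspec, erule mp)
  thus "pinned n S a A u \<le> pinned n S a A w"
    by (auto simp: pinned_def indicator_def)
qed

lemma supported_on_pinned: "supported_on ({j \<in> {1..n}. affects n j A} - S) (pinned n S a A)"
proof -
  let ?r = "\<lambda>u. \<lambda>j\<in>{1..n}. if j \<in> S then a j else u j"
  let ?J = "{j \<in> {1..n}. affects n j A} - S"
  have imp: "?r w \<in> A" if "?r u \<in> A" "\<forall>v\<in>?J. u v = w v" for u w
    by (rule event_determined_by_affecting[OF that(1)]) (use that(2) in \<open>auto simp: Nvec_def\<close>)
  have "?r u \<in> A \<longleftrightarrow> ?r w \<in> A" if "\<forall>v\<in>?J. u v = w v" for u w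
  proof
    show "?r w \<in> A" if "?r u \<in> A" using that \<open>\<forall>v\<in>?J. u v = w v\<close> by (rule imp)
    have "\<forall>v\<in>?J. w v = u v" using \<open>\<forall>v\<in>?J. u v = w v\<close> by simp
    thus "?r u \<in> A" if "?r w \<in> A" by (rule imp[OF that])
  qed
  thus ?thesis
    unfolding supported_on_def pinned_def indicator_def by (intro allI impI arg_cong[where f = of_bool])
qed

lemma pinned_counts:
  assumes "S \<subseteq> {1..n}" "\<forall>v\<in>S. counts {1..m} s v = a v"
  shows "pinned n S a A (counts {1..m} s) = indicator A (occupancy m n s)"
proof -
  have "(\<lambda>j\<in>{1..n}. if j \<in> S then a j else counts {1..m} s j) = occupancy m n s"
    using assms by (auto simp: occupancy_eq_counts fun_eq_iff)
  thus ?thesis unfolding pinned_def by (simp only:)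
qed

lemma occupancy_in_coord_event:
  assumes "S \<subseteq> {1..n}"
  shows "occupancy m n s \<in> coord_event n S a \<longleftrightarrow> (\<forall>v\<in>S. counts {1..m} s v = a v)"
proof -
  have "occupancy m n s v = counts {1..m} s v" if "v \<in> S" for v
    using assms that by (auto simp: occupancy_eq_counts)
  thus ?thesis using occupancy_in_Nvec[of m n s] by (auto simp: coord_event_def)
qed

section \<open>The law of the occupancy numbers\<close>
lemma (in prob_space) occupancy_law:
  assumes "m \<ge> 1" and indep: "indep_vars (\<lambda>_. count_space {1..n}) \<sigma> {1..m}"
  defines "X \<equiv> \<lambda>\<omega>. occupancy m n (\<lambda>i. \<sigma> i \<omega>)"
  shows "X \<in> measurable M (count_space (Nvec n))"
    and "E \<subseteq> Nvec n \<Longrightarrow> measure (distr M (count_space (Nvec n)) X) E =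
      (\<Sum>s\<in>{1..m} \<rightarrow>\<^sub>E {1..n}. indicator E (occupancy m n s) *
        (\<Prod>i\<in>{1..m}. prob (\<sigma> i -` {s i} \<inter> space M)))"
proof -
  define F where "F = {1..m} \<rightarrow>\<^sub>E {1..n}"
  \<comment> \<open>The event that the balls are placed according to \<open>s\<close>.\<close>
  define A where "A s = (\<Inter>i\<in>{1..m}. \<sigma> i -` {s i} \<inter> space M)" for s
  have meas: "\<sigma> i \<in> measurable M (count_space {1..n})" if "i \<in> {1..m}" for i
    using indep that unfolding indep_vars_def by auto
  have A: "A s \<in> events" "prob (A s) = (\<Prod>i\<in>{1..m}. prob (\<sigma> i -` {s i} \<inter> space M))" if "s \<in> F" for s
  proof -
    have s: "{s i} \<in> sets (count_space {1..n})" if "i \<in> {1..m}" for i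
      using that \<open>s \<in> F\<close> by (auto simp: F_def)
    show "A s \<in> events"
      unfolding A_def using assms(1) by (intro sets.finite_INT measurable_sets[OF meas s]) auto
    show "prob (A s) = (\<Prod>i\<in>{1..m}. prob (\<sigma> i -` {s i} \<inter> space M))"
      unfolding A_def using assms(1) s by (intro indep_varsD_finite[OF indep]) auto
  qed
  have preimage: "X -` E \<inter> space M = (\<Union>s\<in>{s \<in> F. occupancy m n s \<in> E}. A s)" for E
  proof (rule set_eqI)
    fix \<omega>
    define s where "s = (\<lambda>i\<in>{1..m}. \<sigma> i \<omega>)"
    have "\<omega> \<in> A t \<longleftrightarrow> \<omega> \<in> space M \<and> t = s" if "t \<in> F" for t
      using that assms(1) by (auto simp: A_def F_def s_def fun_eq_iff PiE_def extensional_def)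
    moreover have "s \<in> F" if "\<omega> \<in> space M"
      using measurable_space[OF meas that] by (auto simp: s_def F_def)
    moreover have "X \<omega> = occupancy m n s"
      unfolding X_def occupancy_def s_def
      by (intro restrict_ext arg_cong[where f = card]) auto
    ultimately show "\<omega> \<in> X -` E \<inter> space M \<longleftrightarrow> \<omega> \<in> (\<Union>s\<in>{s \<in> F. occupancy m n s \<in> E}. A s)"
      by auto
  qed
  have finF: "finite F" by (simp add: F_def finite_PiE)
  show meas_X: "X \<in> measurable M (count_space (Nvec n))"
  proof (rule measurableI)
    show "X -` E \<inter> space M \<in> events" for E
      unfolding preimage using finF A by (intro sets.finite_UN) auto
  qed (simp add: X_def occupancy_in_Nvec)
  assume "E \<subseteq> Nvec n"
  hence "measure (distr M (count_space (Nvec n)) X) E = prob (X -` E \<inter> space M)"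
    using meas_X by (intro measure_distr) auto
  also have "\<dots> = (\<Sum>s\<in>{s \<in> F. occupancy m n s \<in> E}. prob (A s))"
    unfolding preimage
  proof (rule finite_measure_finite_Union)
    have "s i = t i" if "s \<in> F" "t \<in> F" "\<omega> \<in> A s" "\<omega> \<in> A t" for s t \<omega> i
      using that by (cases "i \<in> {1..m}") (auto simp: A_def F_def PiE_def extensional_def)
    hence "s = t" if "s \<in> F" "t \<in> F" "\<omega> \<in> A s" "\<omega> \<in> A t" for s t \<omega>
      using that by blast
    thus "disjoint_family_on A {s \<in> F. occupancy m n s \<in> E}"
      unfolding disjoint_family_on_def by blast
  qed (use finF A in auto)
  also have "\<dots> = (\<Sum>s\<in>F. if occupancy m n s \<in> E then prob (A s) else 0)"
    using finF by (rule sum.inter_filter)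
  also have "\<dots> = (\<Sum>s\<in>F. indicator E (occupancy m n s) *
        (\<Prod>i\<in>{1..m}. prob (\<sigma> i -` {s i} \<inter> space M)))"
    by (rule sum.cong) (auto simp: A)
  finally show "measure (distr M (count_space (Nvec n)) X) E =
      (\<Sum>s\<in>{1..m} \<rightarrow>\<^sub>E {1..n}. indicator E (occupancy m n s) *
        (\<Prod>i\<in>{1..m}. prob (\<sigma> i -` {s i} \<inter> space M)))"
    by (simp add: F_def)
qed

text \<open>
  Multiplying the inequality for the conditional measure by the square of the probability of \<open>C\<close>
  removes the denominators.
\<close>
lemma negatively_associated_uniform_measure:
  assumes \<mu>: "prob_measure_on_Nvec n \<mu>" and C: "C \<subseteq> Nvec n" "0 < measure \<mu> C"
    and ineq: "\<And>A B. increasing_event n A \<Longrightarrow> increasing_event n B \<Longrightarrow> event_perp n A B \<Longrightarrow>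
      measure \<mu> (C \<inter> (A \<inter> B)) * measure \<mu> C \<le> measure \<mu> (C \<inter> A) * measure \<mu> (C \<inter> B)"
  shows "negatively_associated n (uniform_measure \<mu> C)"
proof -
  interpret prob_space \<mu> using \<mu> by (simp add: prob_measure_on_Nvec_def)
  have sets: "sets \<mu> = Pow (Nvec n)" using \<mu> by (simp add: prob_measure_on_Nvec_def)
  have C0: "emeasure \<mu> C \<noteq> 0" using C by (simp add: emeasure_eq_measure)
  have cond: "measure (uniform_measure \<mu> C) A = measure \<mu> (C \<inter> A) / measure \<mu> C"
    if "A \<subseteq> Nvec n" for A
    using C0 C that sets by (intro measure_uniform_measure) auto
  have "prob_measure_on_Nvec n (uniform_measure \<mu> C)"
    unfolding prob_measure_on_Nvec_def using C0 sets by (auto intro!: prob_space_uniform_measure)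
  moreover have "measure (uniform_measure \<mu> C) (A \<inter> B)
      \<le> measure (uniform_measure \<mu> C) A * measure (uniform_measure \<mu> C) B"
    if AB: "increasing_event n A" "increasing_event n B" "event_perp n A B" for A B
  proof -
    have "A \<subseteq> Nvec n" "B \<subseteq> Nvec n" using AB by (auto simp: increasing_event_def)
    moreover from this have "A \<inter> B \<subseteq> Nvec n" by auto
    ultimately show ?thesis
      using ineq[OF AB] C(2) by (simp add: cond field_simps)
  qed
  ultimately show ?thesis by (simp add: negatively_associated_def)
qed

theorem theorem1p3:
  fixes m n :: nat
    and M :: "'w measure"
    and \<sigma> :: "nat \<Rightarrow> 'w \<Rightarrow> nat"
  assumes "m \<ge> 1" and "n \<ge> 1"
    and "prob_space M"
    and "prob_space.indep_vars M (\<lambda>_. count_space {1..n}) \<sigma> {1..m}"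
  shows "conditionally_negatively_associated n
           (distr M (count_space (Nvec n)) (\<lambda>\<omega>. occupancy m n (\<lambda>i. \<sigma> i \<omega>)))"
proof -
  interpret prob_space M by fact
  define X where "X = (\<lambda>\<omega>. occupancy m n (\<lambda>i. \<sigma> i \<omega>))"
  define \<mu> where "\<mu> = distr M (count_space (Nvec n)) X"
  define p where "p i v = prob (\<sigma> i -` {v} \<inter> space M)" for i v
  note law = occupancy_law[OF assms(1,4), folded X_def \<mu>_def p_def]
  have \<mu>: "prob_measure_on_Nvec n \<mu>"
    unfolding prob_measure_on_Nvec_def using prob_space_distr[OF law(1)] by (simp add: \<mu>_def)
  have "negatively_associated n (uniform_measure \<mu> (coord_event n S a))"
    if S: "S \<subseteq> {1..n}" and pos: "measure \<mu> (coord_event n S a) > 0" for a S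
  proof (rule negatively_associated_uniform_measure[OF \<mu> _ pos])
    let ?C = "coord_event n S a"
    show C: "?C \<subseteq> Nvec n" by (auto simp: coord_event_def)
    fix A B assume AB: "increasing_event n A" "increasing_event n B" "event_perp n A B"
    \<comment> \<open>The probability of the placement \<open>s\<close>, restricted to the conditioning event.\<close>
    define w where "w s = of_bool (\<forall>v\<in>S. counts {1..m} s v = a v) * (\<Prod>i\<in>{1..m}. p i (s i))" for s
    have law_C: "measure \<mu> (?C \<inter> E) = (\<Sum>s\<in>{1..m} \<rightarrow>\<^sub>E {1..n}. w s * indicator E (occupancy m n s))" for E
    proof -
      have CE: "?C \<inter> E \<subseteq> Nvec n" using C by auto
      show ?thesis
        unfolding law(2)[OF CE]
        by (intro sum.cong) (auto simp: w_def occupancy_in_coord_event[OF S] indicator_def)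
    qed
    have pin: "w s * pinned n S a E (counts {1..m} s) = w s * indicator E (occupancy m n s)" for s E
      by (cases "\<forall>v\<in>S. counts {1..m} s v = a v") (simp_all add: w_def pinned_counts[OF S] del: One_nat_def)
    have "(\<Sum>s\<in>{1..m} \<rightarrow>\<^sub>E {1..n}. w s * (pinned n S a A (counts {1..m} s) * pinned n S a B (counts {1..m} s)))
        * (\<Sum>s\<in>{1..m} \<rightarrow>\<^sub>E {1..n}. w s)
      \<le> (\<Sum>s\<in>{1..m} \<rightarrow>\<^sub>E {1..n}. w s * pinned n S a A (counts {1..m} s))
        * (\<Sum>s\<in>{1..m} \<rightarrow>\<^sub>E {1..n}. w s * pinned n S a B (counts {1..m} s))"
      unfolding w_def
    proof (rule conditioned_counts)
      show "supported_on ({j \<in> {1..n}. affects n j A} - S) (pinned n S a A)"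
        "supported_on ({j \<in> {1..n}. affects n j B} - S) (pinned n S a B)"
        by (rule supported_on_pinned)+
      show "mono (pinned n S a A)" "mono (pinned n S a B)" using AB by (auto intro: mono_pinned)
      show "({j \<in> {1..n}. affects n j A} - S) \<inter> ({j \<in> {1..n}. affects n j B} - S) = {}"
        using AB(3) by (auto simp: event_perp_def)
    qed (auto simp: p_def)
    moreover have "w s * (pinned n S a A (counts {1..m} s) * pinned n S a B (counts {1..m} s)) =
        w s * indicator (A \<inter> B) (occupancy m n s)" for s
      using pin[of s A] pin[of s B] by (auto simp: indicator_def split: if_splits)
    moreover have "measure \<mu> ?C = (\<Sum>s\<in>{1..m} \<rightarrow>\<^sub>E {1..n}. w s)"
      using law_C[of UNIV] by simp
    ultimately show "measure \<mu> (?C \<inter> (A \<inter> B)) * measure \<mu> ?C \<le> measure \<mu> (?C \<inter> A) * measure \<mu> (?C \<inter> B)"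
      by (simp only: law_C pin)
  qed
  thus ?thesis
    using \<mu> by (simp add: conditionally_negatively_associated_def \<mu>_def X_def)
qed

end
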